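(* Define the Artifact as the Correlation $$C_{\mu^2\cdot\mathbf{1}_{\rm ODD}\cdot\Lambda,\ \Lambda_N^{\rm ODD}}(N,a)=\sum_{2<p\le N}(\log p)\,\Lambda_N^{\rm ODD}(p+a),\qquad a\in\mathbb{N}.$$ Then for every $N\in\mathbb{N}$ with $N\ge 9$ and with neither $N$ nor $N-1$ prime, the Artifact is a Two-Seasons (T-S) Correlation; in particular, for every even $a\in\mathbb{N}$, $$C_{\mu^2\cdot\mathbf{1}_{\rm ODD}\cdot\Lambda,\ \Lambda_N^{\rm ODD}}(N,a)=C_{\mu^2\cdot\mathbf{1}_{\rm ODD}\cdot\Lambda,\ \Lambda_N}(N,a),$$ whence, writing $L=\log N$, $$C_{\Lambda,\Lambda}(N,a)=C_{\mu^2\cdot\mathbf{1}_{\rm ODD}\cdot\Lambda,\ \Lambda_N^{\rm ODD}}(N,a)+O\Big(\big(\sqrt{N}+a\big)\,L\,\log(N+a)\Big)$$ uniformly for all even $a\in\mathbb{N}$ (i.e. with an absolute implied constant, independent of $N$ and $a$).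
   Context: $\mathbb{N}=\{1,2,3,\dots\}$; $p$ always denotes a prime. For $f,g:\mathbb{N}\to\mathbb{C}$ and $N\in\mathbb{N}$ the Correlation of $f$ and $g$ with length $N$ and shift $a\in\mathbb{N}$ is $C_{f,g}(N,a)=\sum_{n\le N}f(n)g(n+a)$ (sum over $1\le n\le N$). The Eratosthenes Transform of $F:\mathbb{N}\to\mathbb{C}$ is $F'(d)=\sum_{t\mid d}F(t)\mu(d/t)$, so $F(n)=\sum_{d\mid n}F'(d)$; here $\mu$ is the Möbius function. The $N$-truncation of $F$ is $F_N(m)=\sum_{d\mid m,\,d\le N}F'(d)$. For $n\in\mathbb{N}$, $n_{\rm ODD}=n/2^{v_2(n)}$ is the odd part of $n$ ($v_2$ the $2$-adic valuation). For $F:\mathbb{N}\to\mathbb{C}$, $F^{\rm ODD}(n)=\sum_{d\mid n,\ d\text{ odd}}F'(d)=F(n_{\rm ODD})$; thus $\Lambda_N^{\rm ODD}=(\Lambda_N)^{\rm ODD}$. $\mathbf{1}_{\rm ODD}$ is the indicator function of the odd natural numbers and $\cdot$ is the pointwise product. $\Lambda$ is the von Mangoldt function ($\Lambda(n)=\log p$ if $n=p^k$ with $k\ge1$, and $0$ otherwise). $C_{f,g}(N,\cdot)$ is called a Two-Seasons (T-S) Correlation if all the following Axioms hold: (0) $g'$ is supported in $[1,Q]$ with $Q\le N$, and the Correlation is Fair, meaning that $f$ and $g$ (their values and supports) do not depend on the shift $a$ (they are fixed functions, possibly depending on $N$); (1) $g'$ is supported on square-free integers; (2) $f$ is supported on prime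 numbers; (3) $g'$ is supported on odd integers and $f$ is supported on odd integers; (4) in (0) one has $Q=N\ge 9$, and neither $N$ nor $N-1$ is prime. *)

theory Defs
  imports
    Complex_Main
    "HOL-Library.Indicator_Function"
    "HOL-Computational_Algebra.Squarefree"
    "HOL-Number_Theory.Prime_Powers"
begin

text \<open>
  Arithmetic functions on the positive integers are rendered as functions of type
  \<^typ>\<open>nat \<Rightarrow> complex\<close> whose value at \<open>0\<close> carries no meaning: everything below that
  is evaluated or quantified concerns arguments \<open>n \<ge> 1\<close> only. The von Mangoldt function is
  \<^const>\<open>mangoldt\<close>.
\<close>

definition moebius :: "nat \<Rightarrow> complex" where
  "moebius n = (if squarefree n then (- 1) ^ card (prime_factors n) else 0)"

definition arith_support :: "(nat \<Rightarrow> complex) \<Rightarrow> nat set" where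
  "arith_support F = {n. n \<ge> 1 \<and> F n \<noteq> 0}"

definition correlation ::
    "(nat \<Rightarrow> complex) \<Rightarrow> (nat \<Rightarrow> complex) \<Rightarrow> nat \<Rightarrow> nat \<Rightarrow> complex" where
  "correlation f g N a = (\<Sum>n\<in>{1..N}. f n * g (n + a))"

definition eratosthenes_transform :: "(nat \<Rightarrow> complex) \<Rightarrow> nat \<Rightarrow> complex" where
  "eratosthenes_transform F d = (\<Sum>t | t dvd d. F t * moebius (d div t))"

definition truncation :: "nat \<Rightarrow> (nat \<Rightarrow> complex) \<Rightarrow> nat \<Rightarrow> complex" where
  "truncation N F m = (\<Sum>d | d dvd m \<and> d \<le> N. eratosthenes_transform F d)"

definition odd_restriction :: "(nat \<Rightarrow> complex) \<Rightarrow> nat \<Rightarrow> complex" where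
  "odd_restriction F n = (\<Sum>d | d dvd n \<and> odd d. eratosthenes_transform F d)"

text \<open>
  The axioms of a Two-Seasons Correlation \<open>C\<^sub>f\<^sub>,\<^sub>g(N, \<cdot>)\<close>. Fairness, the second half of the
  first axiom, says that \<open>f\<close> and \<open>g\<close> do not depend on the shift. It is expressed by the
  arguments: \<open>f\<close>, \<open>g\<close> are single functions, fixed before any shift is chosen, while they may
  vary with the length \<open>N\<close>. The number \<open>Q\<close> is an upper bound for the support of
  the transform of \<open>g\<close>, not necessarily attained.
\<close>

definition ts_axiom0 :: "(nat \<Rightarrow> complex) \<Rightarrow> nat \<Rightarrow> nat \<Rightarrow> bool" where
  "ts_axiom0 g N Q \<longleftrightarrow> arith_support (eratosthenes_transform g) \<subseteq> {1..Q} \<and> Q \<le> N"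

definition ts_axiom1 :: "(nat \<Rightarrow> complex) \<Rightarrow> bool" where
  "ts_axiom1 g \<longleftrightarrow> arith_support (eratosthenes_transform g) \<subseteq> {d. squarefree d}"

definition ts_axiom2 :: "(nat \<Rightarrow> complex) \<Rightarrow> bool" where
  "ts_axiom2 f \<longleftrightarrow> arith_support f \<subseteq> {p. prime p}"

definition ts_axiom3 :: "(nat \<Rightarrow> complex) \<Rightarrow> (nat \<Rightarrow> complex) \<Rightarrow> bool" where
  "ts_axiom3 f g \<longleftrightarrow>
     arith_support (eratosthenes_transform g) \<subseteq> {d. odd d} \<and> arith_support f \<subseteq> {n. odd n}"

definition ts_axiom4 :: "nat \<Rightarrow> nat \<Rightarrow> bool" where
  "ts_axiom4 N Q \<longleftrightarrow> Q = N \<and> N \<ge> 9 \<and> \<not> prime N \<and> \<not> prime (N - 1)"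

definition two_seasons :: "(nat \<Rightarrow> complex) \<Rightarrow> (nat \<Rightarrow> complex) \<Rightarrow> nat \<Rightarrow> bool" where
  "two_seasons f g N \<longleftrightarrow>
     (\<exists>Q. ts_axiom0 g N Q \<and> ts_axiom1 g \<and> ts_axiom2 f \<and> ts_axiom3 f g \<and> ts_axiom4 N Q)"

text \<open>The two functions \<open>\<mu>\<^sup>2 \<cdot> 1\<^sub>O\<^sub>D\<^sub>D \<cdot> \<Lambda>\<close> and \<open>\<Lambda>\<^sub>N\<^sup>O\<^sup>D\<^sup>D\<close> whose Correlation is the Artifact.\<close>

definition odd_squarefree_mangoldt :: "nat \<Rightarrow> complex" where
  "odd_squarefree_mangoldt n = (moebius n)\<^sup>2 * indicator {k. odd k} n * mangoldt n"

definition odd_truncated_mangoldt :: "nat \<Rightarrow> nat \<Rightarrow> complex" where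
  "odd_truncated_mangoldt N = odd_restriction (truncation N mangoldt)"

definition artifact :: "nat \<Rightarrow> nat \<Rightarrow> complex" where
  "artifact N a = correlation odd_squarefree_mangoldt (odd_truncated_mangoldt N) N a"

end

theory Submission
  imports Defs
begin

text \<open>
  The proof rests on the Eratosthenes transform of \<open>\<Lambda>\<close>, which is \<open>- \<mu> log\<close>. Since a
  function on the positive integers is a divisor sum in only one way, truncating a divisor sum
  at \<open>N\<close>, or keeping its odd divisors only, cuts the transform in the same way. So the
  transform of \<open>\<Lambda>\<^sub>N\<^sup>O\<^sup>D\<^sup>D\<close> is \<open>- \<mu> log\<close> restricted to odd \<open>d \<le> N\<close>, which gives the axioms of a
  Two-Seasons Correlation. For even \<open>a\<close> and odd \<open>p\<close> every divisor of \<open>p + a\<close> is odd already, so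
  the restriction to odd divisors does not change the Correlation.

  Passing from \<open>C\<^sub>\<Lambda>\<^sub>,\<^sub>\<Lambda>(N, a)\<close> to the Artifact costs two errors. Replacing the first \<open>\<Lambda>\<close> by its
  restriction to odd primes drops the powers of 2 and the proper prime powers; these are powers
  of primes \<open>p \<le> \<surd>N\<close>, and the powers of one prime contribute at most \<open>log N\<close> to the sum of \<open>\<Lambda>\<close>
  (\<open>sum_mangoldt_not_odd_prime_le\<close>). Replacing the second \<open>\<Lambda>\<close> by \<open>\<Lambda>\<^sub>N\<close> drops the divisors
  \<open>d > N\<close> of \<open>n + a\<close>, each with a coefficient at most \<open>log (N + a)\<close>. A single \<open>n\<close> may have
  many such divisors, but over all \<open>n \<le> N\<close> together there are at most \<open>a\<close> pairs \<open>(n, d)\<close>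
  (\<open>sum_card_large_divisors_le\<close>): this is where the term \<open>a log N log (N + a)\<close> comes from.
\<close>

section \<open>Moebius inversion\<close>

lemma moebius_1 [simp]: "moebius (Suc 0) = 1"
  by (simp add: moebius_def)

lemma moebius_prime_mult:
  fixes p d :: nat
  assumes "prime p" "d > 0"
  shows "moebius (p * d) = (if p dvd d then 0 else - moebius d)"
proof (cases "p dvd d")
  case True
  then have "p ^ 2 dvd p * d"
    by (simp add: power2_eq_square)
  then have "\<not> squarefree (p * d)"
    using assms(1) squarefreeD not_prime_unit by blast
  then show ?thesis
    using True by (simp add: moebius_def)
next
  case False
  then have "coprime p d"
    using assms(1) by (simp add: prime_imp_coprime)
  then have sf: "squarefree (p * d) \<longleftrightarrow> squarefree d"
    using assms(1) squarefree_mult_coprime squarefree_prime squarefree_multD by blast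
  have "prime_factors (p * d) = insert p (prime_factors d)"
    using assms by (simp add: prime_factors_product prime_prime_factors)
  moreover have "p \<notin> prime_factors d"
    using False by (auto dest: in_prime_factors_imp_dvd)
  ultimately show ?thesis
    using False sf by (simp add: moebius_def)
qed

text \<open>
  For a prime \<open>p\<close> dividing \<open>n\<close>, the divisors prime to \<open>p\<close> cancel in pairs \<open>d, p d\<close>
  against the divisors that \<open>p\<close> divides exactly once.
\<close>
lemma sum_moebius_divisors:
  assumes "n > 0"
  shows "(\<Sum>d | d dvd n. moebius d) = (if n = 1 then 1 else 0)"
proof (cases "n = 1")
  case True
  then show ?thesis by simp
next
  case False
  then obtain p where p: "prime p" "p dvd n"
    using prime_factor_nat by blast
  have fin: "finite {d. d dvd n}"
    using assms by simp
  define A where "A = {d. d dvd n \<and> \<not> p dvd d}"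
  define B where "B = {d. d dvd n \<and> p dvd d}"
  have "(\<Sum>d\<in>B. moebius d) = (\<Sum>d\<in>(\<lambda>d. p * d) ` A. moebius d)"
  proof (rule sum.mono_neutral_right)
    show "finite B"
      unfolding B_def by (rule finite_subset[OF _ fin]) auto
    show "(\<lambda>d. p * d) ` A \<subseteq> B"
    proof safe
      fix d assume d: "d \<in> A"
      then have "coprime p d"
        using p(1) by (auto simp: A_def prime_imp_coprime)
      then show "p * d \<in> B"
        using d p(2) by (auto simp: A_def B_def intro: divides_mult)
    qed
    (* such a d is divisible by the square of p *)
    show "\<forall>d \<in> B - (\<lambda>d. p * d) ` A. moebius d = 0"
    proof
      fix d assume d: "d \<in> B - (\<lambda>d. p * d) ` A"
      then obtain e where e: "d = p * e"
        by (auto simp: B_def dvd_def)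
      have "e dvd n" "e > 0"
        using d e assms by (auto simp: B_def intro: dvd_mult_right Nat.gr0I)
      then show "moebius d = 0"
        using d e p(1) by (auto simp: A_def moebius_prime_mult)
    qed
  qed
  also have "\<dots> = (\<Sum>d\<in>A. moebius (p * d))"
    using p(1) by (subst sum.reindex) (auto simp: inj_on_def)
  also have "\<dots> = (\<Sum>d\<in>A. - moebius d)"
    using assms p(1) by (intro sum.cong refl) (auto simp: A_def moebius_prime_mult intro!: Nat.gr0I)
  finally have "(\<Sum>d\<in>A. moebius d) + (\<Sum>d\<in>B. moebius d) = 0"
    by (simp add: sum_negf)
  moreover have "(\<Sum>d | d dvd n. moebius d) = (\<Sum>d\<in>A. moebius d) + (\<Sum>d\<in>B. moebius d)"
    using fin by (subst sum.union_disjoint[symmetric]) (auto simp: A_def B_def intro: sum.cong)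
  ultimately show ?thesis
    using False by simp
qed

text \<open>
  Moebius inversion: in the double sum over \<open>t dvd d dvd n\<close> put \<open>d = t e\<close>; the sum of \<open>\<mu>(e)\<close>
  over the divisors \<open>e\<close> of \<open>n / t\<close> leaves only \<open>t = n\<close>.
\<close>
lemma sum_eratosthenes_transform:
  assumes "n > 0"
  shows "(\<Sum>d | d dvd n. eratosthenes_transform F d) = F n"
proof -
  have fin: "finite {d. d dvd m}" if "m dvd n" for m
    using assms that by (intro finite_divisors_nat) (auto intro!: Nat.gr0I)
  have "(\<Sum>d | d dvd n. eratosthenes_transform F d)
      = (\<Sum>d | d dvd n. \<Sum>t | t dvd d. F t * moebius (d div t))"
    by (simp add: eratosthenes_transform_def)
  also have "\<dots> = (\<Sum>(d, t) \<in> (SIGMA d:{d. d dvd n}. {t. t dvd d}). F t * moebius (d div t))"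
    by (rule sum.Sigma) (use fin in auto)
  also have "\<dots> = (\<Sum>(t, e) \<in> (SIGMA t:{t. t dvd n}. {e. e dvd n div t}). F t * moebius e)"
    by (rule sum.reindex_bij_witness
          [where i = "\<lambda>(t, e). (t * e, t)" and j = "\<lambda>(d, t). (t, d div t)"])
       (use assms in \<open>auto simp: dvd_div_iff_mult mult.commute elim!: dvdE\<close>)
  also have "\<dots> = (\<Sum>t | t dvd n. \<Sum>e | e dvd n div t. F t * moebius e)"
    by (rule sum.Sigma[symmetric]) (use fin in \<open>auto simp: div_dvd_iff_mult\<close>)
  also have "\<dots> = (\<Sum>t | t dvd n. if t = n then F t else 0)"
  proof (rule sum.cong[OF refl])
    fix t assume "t \<in> {t. t dvd n}"
    then obtain k where k: "n = t * k" "t > 0" "k > 0"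
      using assms by (auto elim!: dvdE)
    then show "(\<Sum>e | e dvd n div t. F t * moebius e) = (if t = n then F t else 0)"
      by (simp add: sum_moebius_divisors flip: sum_distrib_left)
  qed
  also have "\<dots> = F n"
    using fin[of n] by (simp add: sum.delta)
  finally show ?thesis .
qed

text \<open>
  Uniqueness of the divisor-sum representation: every transform below is computed by exhibiting
  a representation rather than by evaluating the convolution with the Moebius function.
\<close>
lemma eratosthenes_transform_unique:
  assumes "\<And>n. n > 0 \<Longrightarrow> F n = (\<Sum>d | d dvd n. G d)" and "n > 0"
  shows "eratosthenes_transform F n = G n"
  using \<open>n > 0\<close>
proof (induction n rule: less_induct)
  case (less n)
  have fin: "finite {d. d dvd n}"
    using less.prems by simp
  have split: "sum H {d. d dvd n} = H n + sum H ({d. d dvd n} - {n})" for H :: "nat \<Rightarrow> complex"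
    using fin by (simp add: sum.remove)
  have "sum (eratosthenes_transform F) ({d. d dvd n} - {n}) = sum G ({d. d dvd n} - {n})"
    using less.prems
    by (intro sum.cong refl less.IH) (auto dest: dvd_imp_le intro!: Nat.gr0I le_neq_implies_less)
  moreover have "sum (eratosthenes_transform F) {d. d dvd n} = sum G {d. d dvd n}"
    using assms(1) less.prems by (simp add: sum_eratosthenes_transform)
  ultimately show ?case
    by (simp add: split)
qed

section \<open>Transforms of the von Mangoldt function and of truncations\<close>

text \<open>
  Since \<open>\<Lambda>\<close> is the transform of the logarithm, it equals
  \<open>\<Sum>\<^bsub>d dvd n\<^esub> \<mu>(d) (log n - log d)\<close>, and the term with \<open>log n\<close> vanishes: for \<open>n > 1\<close> because
  the Moebius function sums to zero over the divisors, for \<open>n = 1\<close> because \<open>log 1 = 0\<close>.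
\<close>
lemma eratosthenes_transform_mangoldt:
  assumes "d > 0"
  shows "eratosthenes_transform mangoldt d = - moebius d * of_real (ln (real d))"
proof (rule eratosthenes_transform_unique[OF _ assms])
  fix n :: nat assume n: "n > 0"
  have "mangoldt n = eratosthenes_transform (\<lambda>n. of_real (ln (real n))) n"
    by (rule eratosthenes_transform_unique[symmetric, OF _ n]) (simp add: mangoldt_sum)
  also have "\<dots> = (\<Sum>t | t dvd n. of_real (ln (real t)) * moebius (n div t))"
    by (simp add: eratosthenes_transform_def)
  also have "\<dots> = (\<Sum>d | d dvd n. of_real (ln (real (n div d))) * moebius d)"
    by (rule sum.reindex_bij_witness[where i = "\<lambda>d. n div d" and j = "\<lambda>d. n div d"])
       (use n in \<open>auto elim!: dvdE\<close>)
  also have "\<dots> = (\<Sum>d | d dvd n. of_real (ln (real n)) * moebius d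
                              + (- moebius d * of_real (ln (real d))))"
  proof (rule sum.cong[OF refl])
    fix d assume "d \<in> {d. d dvd n}"
    then have ln_div: "ln (real (n div d)) = ln (real n) - ln (real d)"
      using n by (auto elim!: dvdE simp: ln_mult)
    show "of_real (ln (real (n div d))) * moebius d
        = of_real (ln (real n)) * moebius d + (- moebius d * of_real (ln (real d)))"
      unfolding ln_div by (simp add: algebra_simps)
  qed
  also have "\<dots> = of_real (ln (real n)) * (\<Sum>d | d dvd n. moebius d)
                + (\<Sum>d | d dvd n. - moebius d * of_real (ln (real d)))"
    by (simp only: sum.distrib sum_distrib_left)
  also have "of_real (ln (real n)) * (\<Sum>d | d dvd n. moebius d) = 0"
    using n by (simp add: sum_moebius_divisors)
  finally show "mangoldt n = (\<Sum>d | d dvd n. - moebius d * of_real (ln (real d)))"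
    by simp
qed

lemma norm_eratosthenes_transform_mangoldt_le:
  assumes "d > 0"
  shows "norm (eratosthenes_transform mangoldt d) \<le> ln (real d)"
  using assms by (auto simp: eratosthenes_transform_mangoldt moebius_def norm_mult norm_power)

lemma sum_divisors_restrict:
  fixes H :: "nat \<Rightarrow> complex"
  assumes "n > 0"
  shows "(\<Sum>d | d dvd n \<and> P d. H d) = (\<Sum>d | d dvd n. if P d then H d else 0)"
  using assms by (simp add: sum.inter_filter[symmetric])

lemma eratosthenes_transform_truncation:
  assumes "d > 0"
  shows "eratosthenes_transform (truncation N F) d
       = (if d \<le> N then eratosthenes_transform F d else 0)"
  using assms
  by (intro eratosthenes_transform_unique[where G = "\<lambda>d. if d \<le> N then eratosthenes_transform F d else 0"])
     (simp_all add: truncation_def sum_divisors_restrict)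

lemma eratosthenes_transform_odd_restriction:
  assumes "d > 0"
  shows "eratosthenes_transform (odd_restriction F) d
       = (if odd d then eratosthenes_transform F d else 0)"
  using assms
  by (intro eratosthenes_transform_unique[where G = "\<lambda>d. if odd d then eratosthenes_transform F d else 0"])
     (simp_all add: odd_restriction_def sum_divisors_restrict)

lemma odd_restriction_eq:
  assumes "odd n"
  shows "odd_restriction F n = F n"
proof -
  have "{d. d dvd n \<and> odd d} = {d. d dvd n}"
    using assms dvd_trans by blast
  then show ?thesis
    using assms sum_eratosthenes_transform[of n F] odd_pos[of n] by (simp add: odd_restriction_def)
qed

lemma eratosthenes_transform_odd_truncated_mangoldt:
  assumes "d > 0"
  shows "eratosthenes_transform (odd_truncated_mangoldt N) d
       = (if odd d \<and> d \<le> N then - moebius d * of_real (ln (real d)) else 0)"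
  using assms
  by (simp add: odd_truncated_mangoldt_def eratosthenes_transform_odd_restriction
      eratosthenes_transform_truncation eratosthenes_transform_mangoldt)

text \<open>
  A prime power that is square-free is a prime.
\<close>
lemma odd_squarefree_mangoldt_eq:
  "odd_squarefree_mangoldt n = (if prime n \<and> odd n then of_real (ln (real n)) else 0)"
proof (cases "primepow n \<and> squarefree n")
  case True
  then obtain p k where pk: "prime p" "k > 0" "n = p ^ k"
    by (auto simp: primepow_def)
  then have "k = 1"
    using True prime_gt_1_nat[of p] by (auto simp: squarefree_power_iff)
  then have "prime n"
    using pk by simp
  moreover have "(moebius n)\<^sup>2 = 1"
    using True by (simp add: moebius_def power_even_eq flip: power_mult)
  ultimately show ?thesis
    by (simp add: odd_squarefree_mangoldt_def)
next
  case False
  then have "\<not> prime n"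
    using squarefree_prime by auto
  then show ?thesis
    using False by (auto simp: odd_squarefree_mangoldt_def mangoldt_def moebius_def)
qed

section \<open>The two error terms\<close>

text \<open>
  It suffices that the number of exponents \<open>k\<close> with \<open>p\<^sup>k \<le> N\<close> is at most \<open>log N / log p\<close>.
\<close>
lemma sum_ln_prime_over_powers_le:
  fixes p N :: nat
  assumes "prime p" "N > 0"
  shows "(\<Sum>k | 0 < k \<and> p ^ k \<le> N. ln (real p)) \<le> ln (real N)"
proof -
  have lp: "ln (real p) > 0"
    using prime_gt_1_nat[OF assms(1)] by simp
  have nn: "0 \<le> ln (real N) / ln (real p)"
    using lp assms(2) by simp
  have "{k. 0 < k \<and> p ^ k \<le> N} \<subseteq> {1..nat \<lfloor>ln (real N) / ln (real p)\<rfloor>}"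
  proof
    fix k assume "k \<in> {k. 0 < k \<and> p ^ k \<le> N}"
    then have k: "0 < k" "p ^ k \<le> N" by auto
    have "real k * ln (real p) = ln (real (p ^ k))"
      using prime_gt_0_nat[OF assms(1)] by (simp add: ln_realpow)
    also have "\<dots> \<le> ln (real N)"
      using k prime_gt_0_nat[OF assms(1)] assms(2) by (subst ln_le_cancel_iff) (simp_all flip: of_nat_power)
    finally have "real k \<le> ln (real N) / ln (real p)"
      using lp by (simp add: field_simps)
    then show "k \<in> {1..nat \<lfloor>ln (real N) / ln (real p)\<rfloor>}"
      using k by (simp add: le_nat_floor)
  qed
  then have "card {k. 0 < k \<and> p ^ k \<le> N} \<le> nat \<lfloor>ln (real N) / ln (real p)\<rfloor>"
    by (metis card_atLeastAtMost card_mono diff_Suc_1 finite_atLeastAtMost)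
  then have "real (card {k. 0 < k \<and> p ^ k \<le> N}) \<le> ln (real N) / ln (real p)"
    using nn by linarith
  then show ?thesis
    using lp by (simp add: field_simps)
qed

text \<open>
  A prime power up to \<open>N\<close> that is not an odd prime has its prime base at most \<open>\<surd>N\<close>: either the
  exponent is at least 2, or it is the number 2, for which \<open>N \<ge> 4\<close> is needed.
\<close>
lemma sum_mangoldt_not_odd_prime_le:
  fixes N :: nat
  assumes "N \<ge> 4"
  shows "(\<Sum>n | n \<in> {1..N} \<and> \<not> (prime n \<and> odd n). mangoldt n :: real) \<le> sqrt (real N) * ln (real N)"
proof -
  define P where "P = {p. prime p \<and> p ^ 2 \<le> N}"
  define I where "I = (SIGMA p:P. {k. 0 < k \<and> p ^ k \<le> N})"
  have subP: "P \<subseteq> {1..nat \<lfloor>sqrt (real N)\<rfloor>}"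
  proof
    fix p assume "p \<in> P"
    then have "real p ^ 2 \<le> real N" "p \<ge> 1"
      using prime_ge_1_nat[of p] by (auto simp: P_def simp flip: of_nat_power)
    then show "p \<in> {1..nat \<lfloor>sqrt (real N)\<rfloor>}"
      by (simp add: le_nat_floor real_le_rsqrt)
  qed
  then have finP: "finite P"
    using finite_subset by blast
  have "card P \<le> nat \<lfloor>sqrt (real N)\<rfloor>"
    using subP by (metis card_atLeastAtMost card_mono diff_Suc_1 finite_atLeastAtMost)
  then have cardP: "real (card P) \<le> sqrt (real N)"
    using real_sqrt_ge_zero[of "real N"] by linarith
  have finK: "finite {k. 0 < k \<and> p ^ k \<le> N}" if "p \<in> P" for p
  proof (rule finite_subset[of _ "{..N}"])
    show "{k. 0 < k \<and> p ^ k \<le> N} \<subseteq> {..N}"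
    proof safe
      fix k assume "p ^ k \<le> N"
      moreover have "k < p ^ k"
        using that by (intro power_gt_expt) (auto simp: P_def prime_gt_Suc_0_nat)
      ultimately show "k \<le> N" by simp
    qed
  qed simp
  have finI: "finite I"
    unfolding I_def using finP finK by (rule finite_SigmaI)
  have "(\<Sum>n | n \<in> {1..N} \<and> \<not> (prime n \<and> odd n). mangoldt n :: real)
      = (\<Sum>n | n \<in> {1..N} \<and> \<not> (prime n \<and> odd n) \<and> primepow n. mangoldt n)"
    by (rule sum.mono_neutral_right) (auto simp: mangoldt_def)
  also have "\<dots> \<le> sum mangoldt ((\<lambda>(p, k). p ^ k) ` I)"
  proof (rule sum_mono2)
    show "{n \<in> {1..N}. \<not> (prime n \<and> odd n) \<and> primepow n} \<subseteq> (\<lambda>(p, k). p ^ k) ` I"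
    proof
      fix n assume "n \<in> {n \<in> {1..N}. \<not> (prime n \<and> odd n) \<and> primepow n}"
      then have n': "n \<le> N" "\<not> (prime n \<and> odd n)" "primepow n"
        by auto
      then obtain p k where "prime p" "k > 0" "n = p ^ k"
        unfolding primepow_def by blast
      note n = n'(1,2) this
      have "p ^ 2 \<le> N"
      proof (cases "k = 1")
        case True
        then have "p = 2"
          using n primes_dvd_imp_eq[of 2 p] by auto
        then show ?thesis
          using assms by simp
      next
        case False
        then have "p ^ 2 \<le> p ^ k"
          using n prime_gt_0_nat[of p] by (intro power_increasing) auto
        then show ?thesis
          using n by simp
      qed
      then have "(p, k) \<in> I"
        using n by (simp add: I_def P_def)
      then show "n \<in> (\<lambda>(p, k). p ^ k) ` I"
        using n(5) by force
    qed
  qed (use finI mangoldt_nonneg in auto)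
  also have "\<dots> \<le> sum (mangoldt \<circ> (\<lambda>(p, k). p ^ k)) I"
    by (rule sum_image_le[OF finI]) (rule mangoldt_nonneg)
  also have "\<dots> = (\<Sum>(p, k)\<in>I. ln (real p))"
    by (intro sum.cong refl) (auto simp: I_def P_def)
  also have "\<dots> = (\<Sum>p\<in>P. \<Sum>k | 0 < k \<and> p ^ k \<le> N. ln (real p))"
    unfolding I_def by (rule sum.Sigma[symmetric]) (use finP finK in auto)
  also have "\<dots> \<le> (\<Sum>p\<in>P. ln (real N))"
    using assms by (intro sum_mono sum_ln_prime_over_powers_le) (auto simp: P_def)
  also have "\<dots> \<le> sqrt (real N) * ln (real N)"
    using cardP assms by (simp add: mult_right_mono)
  finally show ?thesis .
qed

text \<open>
  A divisor \<open>d > N\<close> determines \<open>n\<close>, because at most one of \<open>N\<close> consecutive integers is a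
  multiple of \<open>d\<close>; and \<open>d \<le> N + a\<close> leaves only \<open>a\<close> values of \<open>d\<close>.
\<close>
lemma sum_card_large_divisors_le:
  fixes N a :: nat
  shows "(\<Sum>n\<in>{1..N}. card {d. d dvd n + a \<and> d > N}) \<le> a"
proof -
  have fin: "finite {d. d dvd n + a \<and> d > N}" if "n \<in> {1..N}" for n
    using that by (intro finite_subset[OF _ finite_divisors_nat[of "n + a"]]) auto
  define S where "S = (SIGMA n:{1..N}. {d. d dvd n + a \<and> d > N})"
  have "(\<Sum>n\<in>{1..N}. card {d. d dvd n + a \<and> d > N}) = card S"
    unfolding S_def using fin by (subst card_SigmaI) auto
  also have "\<dots> \<le> card {N + 1..N + a}"
  proof (rule card_inj_on_le[where f = snd])
    have eq: "n = m" if "m \<le> n" "n \<le> N" "m \<ge> 1" "d dvd n + a" "d dvd m + a" "d > N" for m n d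
    proof -
      have "d dvd n - m"
        using dvd_diff_nat[OF that(4,5)] by simp
      moreover have "n - m < d"
        using that by simp
      ultimately have "n - m = 0"
        using nat_dvd_not_less by blast
      then show "n = m"
        using that(1) by simp
    qed
    show "inj_on snd S"
    proof (rule inj_onI)
      fix x y assume "x \<in> S" "y \<in> S" "snd x = snd y"
      then show "x = y"
        using eq[of "fst x" "fst y" "snd x"] eq[of "fst y" "fst x" "snd x"]
        by (cases x; cases y) (auto simp: S_def not_le intro: le_cases)
    qed
    show "snd ` S \<subseteq> {N + 1..N + a}"
      by (auto simp: S_def dest!: dvd_imp_le)
  qed simp
  finally show ?thesis
    by simp
qed

text \<open>
  By Moebius inversion \<open>\<Lambda>(m) - \<Lambda>\<^sub>N(m)\<close> is the sum of \<open>- \<mu>(d) log d\<close> over the divisors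
  \<open>d > N\<close> of \<open>m\<close>.
\<close>
lemma norm_mangoldt_minus_truncation_le:
  assumes "n \<in> {1..N}"
  shows "norm (mangoldt (n + a) - truncation N mangoldt (n + a))
       \<le> real (card {d. d dvd n + a \<and> d > N}) * ln (real (N + a))"
proof -
  let ?E = "eratosthenes_transform mangoldt"
  have fin: "finite {d. d dvd n + a}"
    using assms by simp
  have "mangoldt (n + a) = sum ?E {d. d dvd n + a}"
    using assms by (simp add: sum_eratosthenes_transform)
  also have "{d. d dvd n + a} = {d. d dvd n + a \<and> d \<le> N} \<union> {d. d dvd n + a \<and> d > N}"
    by auto
  also have "sum ?E \<dots> = sum ?E {d. d dvd n + a \<and> d \<le> N} + sum ?E {d. d dvd n + a \<and> d > N}"
    by (rule sum.union_disjoint) (auto intro: finite_subset[OF _ fin])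
  finally have "mangoldt (n + a) - truncation N mangoldt (n + a) = sum ?E {d. d dvd n + a \<and> d > N}"
    by (simp add: truncation_def)
  also have "norm \<dots> \<le> (\<Sum>d | d dvd n + a \<and> d > N. ln (real (N + a)))"
  proof (rule sum_norm_le)
    fix d assume "d \<in> {d. d dvd n + a \<and> d > N}"
    then have d: "0 < d" "d \<le> N + a"
      using assms dvd_imp_le[of d "n + a"] by auto
    have "norm (?E d) \<le> ln (real d)"
      using d(1) by (rule norm_eratosthenes_transform_mangoldt_le)
    also have "\<dots> \<le> ln (real (N + a))"
      using d by (subst ln_le_cancel_iff) auto
    finally show "norm (?E d) \<le> ln (real (N + a))" .
  qed
  finally show ?thesis
    by simp
qed

section \<open>The Artifact\<close>

text \<open>
  For \<open>n\<close> in the support of the first factor, \<open>n + a\<close> is odd, and so are all its divisors.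
\<close>
lemma artifact_eq_truncation:
  assumes "even a"
  shows "artifact N a = correlation odd_squarefree_mangoldt (truncation N mangoldt) N a"
  unfolding artifact_def correlation_def
  using assms
  by (intro sum.cong refl)
     (simp add: odd_squarefree_mangoldt_eq odd_truncated_mangoldt_def odd_restriction_eq)

text \<open>
  The difference splits as
  \<open>\<Sum> (\<Lambda>(n) - f(n)) \<Lambda>(n + a) + \<Sum> f(n) (\<Lambda>(n + a) - \<Lambda>\<^sub>N(n + a))\<close>, with \<open>f\<close> the restriction of
  \<open>\<Lambda>\<close> to odd primes. The first sum is supported on prime powers with base at most \<open>\<surd>N\<close>, the
  second is controlled by the divisors of \<open>n + a\<close> beyond \<open>N\<close>. The implied constant is 1.
\<close>
lemma norm_correlation_mangoldt_minus_artifact_le: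
  assumes "N \<ge> 4" "even a"
  shows "norm (correlation mangoldt mangoldt N a - artifact N a)
       \<le> (sqrt (real N) + real a) * ln (real N) * ln (real (N + a))"
proof -
  let ?f = odd_squarefree_mangoldt and ?T = "truncation N mangoldt"
  let ?L = "ln (real N)" and ?M = "ln (real (N + a))"
  define c where "c n = card {d. d dvd n + a \<and> d > N}" for n
  have LM: "?L \<ge> 0" "?M \<ge> 0"
    using assms by auto
  have "(\<Sum>n\<in>{1..N}. (if prime n \<and> odd n then 0 else mangoldt n) * ?M)
      = (\<Sum>n | n \<in> {1..N} \<and> \<not> (prime n \<and> odd n). mangoldt n) * ?M"
    unfolding sum_distrib_right by (intro sum.mono_neutral_cong_right) auto
  also have "\<dots> \<le> (sqrt (real N) * ?L) * ?M"
    using LM sum_mangoldt_not_odd_prime_le[OF assms(1)] by (intro mult_right_mono)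
  finally have first: "(\<Sum>n\<in>{1..N}. (if prime n \<and> odd n then 0 else mangoldt n) * ?M)
      \<le> (sqrt (real N) * ?L) * ?M" .
  have "(\<Sum>n\<in>{1..N}. ?L * (real (c n) * ?M)) = real (\<Sum>n\<in>{1..N}. c n) * (?L * ?M)"
    by (simp add: sum_distrib_right sum_distrib_left mult_ac)
  also have "\<dots> \<le> real a * (?L * ?M)"
    using LM sum_card_large_divisors_le[of a N]
    by (intro mult_right_mono) (auto simp: c_def simp del: of_nat_sum)
  finally have second: "(\<Sum>n\<in>{1..N}. ?L * (real (c n) * ?M)) \<le> real a * (?L * ?M)" .
  have "correlation mangoldt mangoldt N a - artifact N a
      = (\<Sum>n\<in>{1..N}. (mangoldt n - ?f n) * mangoldt (n + a))
      + (\<Sum>n\<in>{1..N}. ?f n * (mangoldt (n + a) - ?T (n + a)))"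
    unfolding artifact_eq_truncation[OF assms(2)] correlation_def
    by (simp add: algebra_simps flip: sum.distrib sum_subtractf)
  moreover have "norm ((\<Sum>n\<in>{1..N}. (mangoldt n - ?f n) * mangoldt (n + a))
      + (\<Sum>n\<in>{1..N}. ?f n * (mangoldt (n + a) - ?T (n + a))))
    \<le> (\<Sum>n\<in>{1..N}. (if prime n \<and> odd n then 0 else mangoldt n) * ?M)
      + (\<Sum>n\<in>{1..N}. ?L * (real (c n) * ?M))"
  proof (intro norm_triangle_mono sum_norm_le)
    fix n assume n: "n \<in> {1..N}"
    have "mangoldt (n + a) \<le> ln (real (n + a))"
      using n by (intro mangoldt_le) auto
    also have "\<dots> \<le> ?M"
      using n by (subst ln_le_cancel_iff) auto
    finally show "norm ((mangoldt n - ?f n) * mangoldt (n + a))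
        \<le> (if prime n \<and> odd n then 0 else mangoldt n) * ?M"
      by (auto simp: norm_mult odd_squarefree_mangoldt_eq mangoldt_nonneg intro!: mult_left_mono)
    have "norm (?f n) \<le> ?L"
      using n LM by (auto simp: odd_squarefree_mangoldt_eq)
    then show "norm (?f n * (mangoldt (n + a) - ?T (n + a))) \<le> ?L * (real (c n) * ?M)"
      using LM norm_mangoldt_minus_truncation_le[OF n, of a]
      by (auto simp: norm_mult c_def intro!: mult_mono)
  qed
  ultimately show ?thesis
    using first second by (simp only: ring_distribs mult.assoc)
qed

lemma artifact_eq_sum_primes:
  "artifact N a = (\<Sum>p | prime p \<and> 2 < p \<and> p \<le> N.
     complex_of_real (ln (real p)) * odd_truncated_mangoldt N (p + a))"
  unfolding artifact_def correlation_def
proof (rule sum.mono_neutral_cong_right)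
  show "{p. prime p \<and> 2 < p \<and> p \<le> N} \<subseteq> {1..N}"
    by auto
  have "2 < n" if "prime n" "odd n" for n :: nat
    using that prime_ge_2_nat[of n] by (cases "n = 2") auto
  then show "\<forall>n\<in>{1..N} - {p. prime p \<and> 2 < p \<and> p \<le> N}.
      odd_squarefree_mangoldt n * odd_truncated_mangoldt N (n + a) = 0"
    by (auto simp: odd_squarefree_mangoldt_eq)
next
  fix n assume "n \<in> {p. prime p \<and> 2 < p \<and> p \<le> N}"
  then show "odd_squarefree_mangoldt n * odd_truncated_mangoldt N (n + a)
      = complex_of_real (ln (real n)) * odd_truncated_mangoldt N (n + a)"
    by (auto simp: odd_squarefree_mangoldt_eq prime_odd_nat)
qed simp

lemma two_seasons_artifact:
  assumes "N \<ge> 9" "\<not> prime N" "\<not> prime (N - 1)"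
  shows "two_seasons odd_squarefree_mangoldt (odd_truncated_mangoldt N) N"
proof -
  have "d \<le> N \<and> odd d \<and> squarefree d"
    if "d \<in> arith_support (eratosthenes_transform (odd_truncated_mangoldt N))" for d
    using that
    by (auto simp: arith_support_def eratosthenes_transform_odd_truncated_mangoldt moebius_def
        split: if_splits)
  then have "ts_axiom0 (odd_truncated_mangoldt N) N N" "ts_axiom1 (odd_truncated_mangoldt N)"
    "ts_axiom3 odd_squarefree_mangoldt (odd_truncated_mangoldt N)"
    by (auto simp: ts_axiom0_def ts_axiom1_def ts_axiom3_def arith_support_def
        odd_squarefree_mangoldt_eq split: if_splits)
  moreover have "ts_axiom2 odd_squarefree_mangoldt"
    by (auto simp: ts_axiom2_def arith_support_def odd_squarefree_mangoldt_eq)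
  moreover have "ts_axiom4 N N"
    using assms by (simp add: ts_axiom4_def)
  ultimately show ?thesis
    unfolding two_seasons_def by blast
qed

theorem theorem5p3:
  shows "(\<forall>N a :: nat. N \<ge> 1 \<longrightarrow> a \<ge> 1 \<longrightarrow>
            artifact N a =
              (\<Sum>p | prime p \<and> 2 < p \<and> p \<le> N.
                 complex_of_real (ln (real p)) * odd_truncated_mangoldt N (p + a)))
       \<and> (\<forall>N :: nat. N \<ge> 9 \<and> \<not> prime N \<and> \<not> prime (N - 1) \<longrightarrow>
            two_seasons odd_squarefree_mangoldt (odd_truncated_mangoldt N) N
            \<and> (\<forall>a :: nat. a \<ge> 1 \<and> even a \<longrightarrow>
                 artifact N a = correlation odd_squarefree_mangoldt (truncation N mangoldt) N a))
       \<and> (\<exists>K :: real. \<forall>N a :: nat.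
            N \<ge> 9 \<and> \<not> prime N \<and> \<not> prime (N - 1) \<and> a \<ge> 1 \<and> even a \<longrightarrow>
            norm (correlation mangoldt mangoldt N a - artifact N a)
              \<le> K * ((sqrt (real N) + real a) * ln (real N) * ln (real (N + a))))"
proof (intro conjI)
  show "\<exists>K :: real. \<forall>N a :: nat.
      N \<ge> 9 \<and> \<not> prime N \<and> \<not> prime (N - 1) \<and> a \<ge> 1 \<and> even a \<longrightarrow>
      norm (correlation mangoldt mangoldt N a - artifact N a)
        \<le> K * ((sqrt (real N) + real a) * ln (real N) * ln (real (N + a)))"
  proof (rule exI[of _ 1], intro allI impI)
    fix N a :: nat
    assume "N \<ge> 9 \<and> \<not> prime N \<and> \<not> prime (N - 1) \<and> a \<ge> 1 \<and> even a"
    then show "norm (correlation mangoldt mangoldt N a - artifact N a)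
        \<le> 1 * ((sqrt (real N) + real a) * ln (real N) * ln (real (N + a)))"
      using norm_correlation_mangoldt_minus_artifact_le[of N a] by linarith
  qed
qed (use artifact_eq_sum_primes two_seasons_artifact artifact_eq_truncation in blast)+

end
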